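(* Let $B\ge2$ be an integer base, let $m\ge2$ be an arbitrary integer, and let $\mathfrak{B}_0\supset\mathfrak{B}_1\supset\mathfrak{B}_2\supset\cdots$ be a linear-fragmentation process starting from a fixed $m$-dimensional box $\mathfrak{B}_0$, where $P_i^{(j)}\in(0,1)$ denotes the proportion cut along the $i$-th axis at stage $j$. Suppose that the following hold. 1. The $P_i^{(j)}$ are i.i.d. for all $1\le i\le m$ and all stages $j$: they are all independent and there is a random variable $P$ such that $P_i^{(j)}\sim P$ for all $i,j$. 2. Let $\mu_P$ and $\sigma_P^2$ be the mean and the variance of $\log_B(P)$. Then $\log_B(P)$ has finite centered moments, i.e. $\mathbb{E}[(\log_B(P)-\mu_P)^k]<\infty$ for all $k\ge1$, and the characteristic function of $(\log_B(P)-\mu_P)/\sigma_P$ admits a Taylor expansion (at the origin). Moreover, the variance $\sigma_P^2$ is nonzero. 3. Let $f$ be the probability density function of $\log_B(P)$; then $\operatorname{ess\,sup}_x f(x)<\infty$. 4. $f$ is differentiable with $\sup_x|f'(x)|<\infty$. Then for every integer $1\le d\le m$, the maximum product $\mathfrak{m}_d^{(N)}$ of $d$ sides of $\mathfrak{B}_N$ converges to strong Benford behavior in base $B$ as $N\to\infty$; and consequently, for every integer $1\le d\le m$, the $d$-volume $V_d^{(N)}:=\mathrm{Vol}_d(\mathfrak{B}_N)$ converges to strong Benford behavior in base $B$ as $N\to\infty$.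
   Context: Box: an $m$-dimensional box is a set of the form $[a_1,b_1]\times\cdots\times[a_m,b_m]\subset\mathbb{R}^m$ with real $a_i<b_i$. Linear-fragmentation process: a sequence of random variables $\mathfrak{B}_0,\mathfrak{B}_1,\mathfrak{B}_2,\dots$ such that: (i) each $\mathfrak{B}_n$ is an $m$-dimensional box; (ii) $\mathfrak{B}_0\supset\mathfrak{B}_1\supset\mathfrak{B}_2\supset\cdots$; (iii) the distribution of $\mathfrak{B}_{n+1}$ conditioned on $\mathfrak{B}_n$ is some fixed distribution of independent proportion cuts $P_1,\dots,P_m$ along each Cartesian axis, fixed over all $n\ge0$ (so the $i$-th side length of $\mathfrak{B}_{n+1}$ is the $i$-th side length of $\mathfrak{B}_n$ multiplied by the stage-$(n+1)$ cut $P_i^{(n+1)}$, a fresh copy of $P_i$); (iv) the proportion cuts $P_i$ are continuous random variables (with values in $(0,1)$); (v) $\mathbb{E}[\log_B P_i]=\mu_P\in\mathbb{R}$ and $\mathrm{Var}[\log_B P_i]=\sigma_P^2>0$ for all $1\le i\le m$. $d$-volume: for a box $\mathfrak{B}=\prod_{i=1}^m[a_i,b_i]$ and a positive integer $d\le m$, $\mathrm{Vol}_d(\mathfrak{B}):=2^{m-d}\sum_{|I|=d}\prod_{i\in I}(b_i-a_i)$, the sum being over all subsets $I\subset\{1,\dots,m\}$ of cardinality $d$. Maximum product: $\mathfrak{m}_d^{(N)}:=\max_{|I|=d}\prod_{i\in I}s_i$, where $s_1,\dots,s_m$ are the side lengths of $\mathfrak{B}_N$. Strong Benford behavior: for $x>0$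 write uniquely $x=S_B(x)B^{k_B(x)}$ with $S_B(x)\in[1,B)$ and $k_B(x)\in\mathbb{Z}$. A sequence of positive random variables $\{X^{(N)}\}_{N\ge1}$ converges to strong Benford behavior in base $B$ if $\lim_{N\to\infty}\mathbb{P}(S_B(X^{(N)})\le s)=\log_B(s)$ for all $s\in[1,B)$. *)

theory Defs
  imports "HOL-Probability.Probability"
begin

section \<open>Boxes\<close>

definition is_box :: "(real ^ 'm) set \<Rightarrow> bool" where
  "is_box S \<longleftrightarrow> (\<exists>a b. (\<forall>i. a $ i < b $ i) \<and> S = cbox a b)"

definition side :: "(real ^ 'm) set \<Rightarrow> 'm \<Rightarrow> real" where
  "side S i = interval_upperbound S $ i - interval_lowerbound S $ i"

definition box_corners :: "(real ^ 'm) set \<Rightarrow> (real ^ 'm) \<times> (real ^ 'm)" where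
  "box_corners S = (interval_lowerbound S, interval_upperbound S)"

lemma box_corners_cbox:
  fixes a b :: "real ^ 'm"
  assumes "\<And>i. a $ i < b $ i"
  shows "box_corners (cbox a b) = (a, b)"
proof -
  have "a \<bullet> u \<le> b \<bullet> u" if "u \<in> Basis" for u
    using that assms by (auto simp: Basis_vec_def inner_axis less_imp_le)
  then show ?thesis
    by (simp add: box_corners_def)
qed

lemma side_cbox:
  fixes a b :: "real ^ 'm"
  assumes "\<And>i. a $ i < b $ i"
  shows "side (cbox a b) i = b $ i - a $ i"
  using box_corners_cbox[OF assms] by (simp add: box_corners_def side_def)

definition d_volume :: "nat \<Rightarrow> (real ^ 'm) set \<Rightarrow> real" where
  "d_volume d S = 2 ^ (CARD('m) - d) * (\<Sum>I | card I = d. \<Prod>i\<in>I. side S i)"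

definition max_product :: "nat \<Rightarrow> (real ^ 'm) set \<Rightarrow> real" where
  "max_product d S = Max ((\<lambda>I. \<Prod>i\<in>I. side S i) ` {I. card I = d})"

section \<open>Strong Benford behavior\<close>

definition significand :: "real \<Rightarrow> real \<Rightarrow> real" where
  "significand b x = (THE s. 1 \<le> s \<and> s < b \<and> (\<exists>k::int. x = s * b powi k))"

lemma significand_unique:
  fixes b x :: real
  assumes "1 < b" "0 < x"
  shows "\<exists>!s. 1 \<le> s \<and> s < b \<and> (\<exists>k::int. x = s * b powi k)"
proof (rule ex1I)
  define k where "k = \<lfloor>log b x\<rfloor>"
  define s where "s = x / b powr real_of_int k"
  have "real_of_int k \<le> log b x" "log b x < real_of_int k + 1"
    by (auto simp: k_def)
  then have "b powr real_of_int k \<le> x" "x < b powr (real_of_int k + 1)"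
    using assms by (simp_all add: le_log_iff log_less_iff)
  then show "1 \<le> s \<and> s < b \<and> (\<exists>k::int. x = s * b powi k)"
    using assms
    by (auto simp: s_def powr_add field_simps powr_real_of_int' intro!: exI[of _ k])
  fix t assume t: "1 \<le> t \<and> t < b \<and> (\<exists>k::int. x = t * b powi k)"
  then obtain l :: int where l: "x = t * b powi l" by blast
  have lg: "log b x = log b t + real_of_int l"
    using t assms l by (simp add: log_mult powr_real_of_int'[symmetric])
  have "0 \<le> log b t" "log b t < 1"
    using t assms by (simp_all add: log_less_iff)
  then have "k = l"
    unfolding k_def lg by linarith
  then show "t = s"
    using l assms by (simp add: s_def powr_real_of_int')
qed

definition strong_benford :: "real \<Rightarrow> 'w measure \<Rightarrow> (nat \<Rightarrow> 'w \<Rightarrow> real) \<Rightarrow> bool" where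
  "strong_benford b M X \<longleftrightarrow>
     (\<forall>N\<ge>1. X N \<in> borel_measurable M \<and> (\<forall>\<omega>\<in>space M. 0 < X N \<omega>)) \<and>
     (\<forall>s\<in>{1..<b}.
        (\<lambda>N. measure M {\<omega> \<in> space M. significand b (X N \<omega>) \<le> s}) \<longlonglongrightarrow> log b s)"

section \<open>Linear fragmentation\<close>

text \<open>
  \<open>P i j\<close> is the proportion cut along axis \<open>i\<close> at stage \<open>j \<ge> 1\<close> (the values at
  \<open>j = 0\<close> play no role). A random box is measurable when its pair of corners is. That the conditional
  law of the next box given the current one is always given by the same independent cuts is
  expressed by the cuts of each stage being independent of each other, independent of the current
  box, and having stage-independent laws.
\<close>

locale linear_fragmentation = prob_space M
  for M :: "'w measure" +
  fixes b :: real
    and Bx :: "nat \<Rightarrow> 'w \<Rightarrow> (real ^ 'm) set"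
    and P :: "'m \<Rightarrow> nat \<Rightarrow> 'w \<Rightarrow> real"
    and \<mu> \<sigma> :: real
  assumes box: "\<And>n \<omega>. \<omega> \<in> space M \<Longrightarrow> is_box (Bx n \<omega>)"
    and corners_measurable: "\<And>n. (\<lambda>\<omega>. box_corners (Bx n \<omega>)) \<in> borel_measurable M"
    and decreasing: "\<And>n \<omega>. \<omega> \<in> space M \<Longrightarrow> Bx (Suc n) \<omega> \<subseteq> Bx n \<omega>"
    and side_Suc: "\<And>n i \<omega>. \<omega> \<in> space M \<Longrightarrow>
          side (Bx (Suc n) \<omega>) i = P i (Suc n) \<omega> * side (Bx n \<omega>) i"
    and cuts_indep: "\<And>n. indep_vars (\<lambda>_. borel) (\<lambda>i. P i (Suc n)) UNIV"
    and cuts_fresh: "\<And>n. indep_set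
          (sets (vimage_algebra (space M) (\<lambda>\<omega>. box_corners (Bx n \<omega>)) borel))
          (sets (vimage_algebra (space M) (\<lambda>\<omega>. \<chi> i. P i (Suc n) \<omega>) borel))"
    and cuts_law: "\<And>n i. distr M borel (P i (Suc n)) = distr M borel (P i 1)"
    and cuts_range: "\<And>n i \<omega>. \<omega> \<in> space M \<Longrightarrow> P i (Suc n) \<omega> \<in> {0<..<1}"
    and cuts_continuous: "\<And>n i. \<exists>g. distributed M lborel (P i (Suc n)) g"
    and log_integrable: "\<And>n i. integrable M (\<lambda>\<omega>. log b (P i (Suc n) \<omega>))"
    and log_mean: "\<And>n i. expectation (\<lambda>\<omega>. log b (P i (Suc n) \<omega>)) = \<mu>"
    and log_sq_integrable: "\<And>n i. integrable M (\<lambda>\<omega>. (log b (P i (Suc n) \<omega>))\<^sup>2)"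
    and log_variance: "\<And>n i. variance (\<lambda>\<omega>. log b (P i (Suc n) \<omega>)) = \<sigma>\<^sup>2"
    and sigma_pos: "0 < \<sigma>"

section \<open>Taylor expansion\<close>

text \<open>
  A complex-valued function of a real variable is the sum of a power series near the origin; the
  coefficients are then necessarily its Taylor coefficients.
\<close>

definition has_taylor_expansion_at_0 :: "(real \<Rightarrow> complex) \<Rightarrow> bool" where
  "has_taylor_expansion_at_0 \<phi> \<longleftrightarrow>
     (\<exists>a. \<exists>r>0. \<forall>t. \<bar>t\<bar> < r \<longrightarrow> (\<lambda>k. a k * complex_of_real t ^ k) sums \<phi> t)"

end

theory Submission
  imports Defs
begin

text \<open>
  The key is that the law of the logarithmic side lengths becomes insensitive to translations. Let
  \<open>\<nu>\<close> be the law of the logarithm of a single cut. The logarithm of side \<open>i\<close> after \<open>N\<close> stages is a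
  constant plus a random walk with step law \<open>\<nu>\<close>, and the walks of different sides are independent. If
  \<open>\<nu>\<close> has a continuous density, then for every small \<open>t\<close> the total variation distance between the law
  of such a walk after \<open>N\<close> steps and its translate by \<open>t\<close> tends to \<open>0\<close> (lemma
  \<open>shift_gap_density_tendsto_0\<close>). Translating one coordinate at a time, the same holds for the vector
  of all logarithmic sides and the translation by \<open>t\<close> along the diagonal (lemma \<open>expectation_shift\<close>).

  For a single walk the reason is that a part of each step, of probability \<open>c > 0\<close>, can be taken to be
  uniform on an interval or uniform on the translate of that interval by \<open>t\<close>. Were the distance to stay
  near a limit \<open>G > 0\<close>, some test function would have an increment close to \<open>G\<close> on average, and after
  \<open>j\<close> further steps these increments would be close to \<open>G\<close> along a whole progression of \<open>j + 1\<close>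
  points with spacing \<open>t\<close>. They add up to an increment of a bounded function, so \<open>(j + 1) G\<close> is bounded
  independently of \<open>j\<close>, which forces \<open>G = 0\<close> (lemmas \<open>shift_gap_recurrence\<close> and \<open>shift_gap_tendsto_0\<close>).

  Both the maximum product and the \<open>d\<close>-volume are homogeneous of degree \<open>d\<close> in the side lengths, so a
  diagonal translation by \<open>t = 1 / (d q)\<close> adds exactly \<open>1 / q\<close> to the logarithm of either of
  them. Modulo \<open>1\<close> this is the rotation that permutes the \<open>q\<close> arcs
  \<open>[j / q, (j + 1) / q)\<close> cyclically, so these arcs all receive asymptotically the same probability
  \<open>1 / q\<close>. As \<open>q\<close> is arbitrarily large, the fractional part of the logarithm converges to the uniform
  distribution (lemma \<open>frac_equivariant_equidistributed\<close>), which is strong Benford behavior.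
\<close>

section \<open>Averaging operators of probability measures on the line\<close>

definition bounded_borel :: "real \<Rightarrow> (real \<Rightarrow> real) set" where
  "bounded_borel C = {h \<in> borel_measurable borel. \<forall>x. \<bar>h x\<bar> \<le> C}"

text \<open>
  The \<open>n\<close>-th iterate of this operator at \<open>y\<close> is the expectation of \<open>h (y + S)\<close> for a sum \<open>S\<close> of \<open>n\<close>
  independent steps with law \<open>\<nu>\<close>; see \<open>expectation_random_walk\<close>. Working with the operators replaces
  convolution powers of measures by iterates of a function.
\<close>

definition average :: "real measure \<Rightarrow> (real \<Rightarrow> real) \<Rightarrow> real \<Rightarrow> real" where
  "average \<nu> h y = (\<integral>x. h (y + x) \<partial>\<nu>)"

lemma bounded_borelD:
  assumes "h \<in> bounded_borel C"
  shows "h \<in> borel_measurable borel" "\<bar>h x\<bar> \<le> C"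
  using assms by (auto simp: bounded_borel_def)

lemma bounded_borel_translate:
  "h \<in> bounded_borel C \<Longrightarrow> (\<lambda>x. h (x + t)) \<in> bounded_borel C"
  by (auto simp: bounded_borel_def)

lemma bounded_borel_uminus:
  "h \<in> bounded_borel C \<Longrightarrow> (\<lambda>x. - h x) \<in> bounded_borel C"
  by (auto simp: bounded_borel_def)

lemma bounded_borel_diff:
  assumes "h \<in> bounded_borel C" "k \<in> bounded_borel D"
  shows "(\<lambda>x. h x - k x) \<in> bounded_borel (C + D)"
  unfolding bounded_borel_def
proof (intro CollectI conjI allI)
  show "(\<lambda>x. h x - k x) \<in> borel_measurable borel"
    using assms by (intro borel_measurable_diff) (auto dest: bounded_borelD)
  show "\<bar>h x - k x\<bar> \<le> C + D" for x
    using bounded_borelD(2)[OF assms(1), of x] bounded_borelD(2)[OF assms(2), of x] by linarith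
qed

context real_distribution
begin

lemma prob_UNIV: "prob UNIV = 1"
  using prob_space by simp

lemma integrable_bounded_borel:
  assumes "h \<in> bounded_borel C"
  shows "integrable M (\<lambda>x. h (y + x))"
proof (rule integrable_const_bound[where B = C])
  show "AE x in M. norm (h (y + x)) \<le> C"
    using bounded_borelD(2)[OF assms] by simp
  have [measurable]: "h \<in> borel_measurable borel"
    by (rule bounded_borelD(1)[OF assms])
  show "random_variable borel (\<lambda>x. h (y + x))"
    by measurable
qed

lemma average_bounded_borel:
  assumes "h \<in> bounded_borel C"
  shows "average M h \<in> bounded_borel C"
  unfolding bounded_borel_def
proof (intro CollectI conjI allI)
  have [measurable]: "h \<in> borel_measurable borel"
    by (rule bounded_borelD(1)[OF assms])
  have "(\<lambda>y. \<integral>x. h (y + x) \<partial>M) \<in> borel_measurable borel"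
    by measurable
  then show "average M h \<in> borel_measurable borel"
    by (simp add: average_def[abs_def])
next
  fix y
  have "\<bar>average M h y\<bar> \<le> (\<integral>x. \<bar>h (y + x)\<bar> \<partial>M)"
    unfolding average_def by (rule integral_abs_bound)
  also have "\<dots> \<le> (\<integral>x. C \<partial>M)"
    using integrable_bounded_borel[OF assms] bounded_borelD(2)[OF assms]
    by (intro integral_mono) auto
  finally show "\<bar>average M h y\<bar> \<le> C"
    by (simp add: prob_UNIV)
qed

lemma average_mono:
  assumes "h \<in> bounded_borel C" "k \<in> bounded_borel D" "\<And>x. h x \<le> k x"
  shows "average M h y \<le> average M k y"
  unfolding average_def
  using assms by (intro integral_mono integrable_bounded_borel)

lemma average_diff:
  assumes "h \<in> bounded_borel C" "k \<in> bounded_borel D"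
  shows "average M (\<lambda>x. h x - k x) y = average M h y - average M k y"
  unfolding average_def
  using assms by (intro Bochner_Integration.integral_diff integrable_bounded_borel)

lemma average_const: "average M (\<lambda>x. a) y = a"
  by (simp add: average_def prob_UNIV)

lemma average_translate: "average M (\<lambda>x. h (x + t)) y = average M h (y + t)"
  by (simp add: average_def ac_simps)

lemma average_affine:
  assumes "h \<in> bounded_borel C"
  shows "average M (\<lambda>x. a * h (x + t) + e) y = a * average M h (y + t) + e"
proof -
  have "integrable M (\<lambda>x. h (y + t + x))"
    using integrable_bounded_borel[OF assms] .
  then show ?thesis
    by (simp add: average_def prob_UNIV ac_simps)
qed

lemma average_iter_bounded_borel:
  "h \<in> bounded_borel C \<Longrightarrow> (average M ^^ n) h \<in> bounded_borel C"
  by (induction n) (auto intro: average_bounded_borel)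

lemma average_iter_translate:
  "(average M ^^ n) (\<lambda>x. h (x + t)) = (\<lambda>y. (average M ^^ n) h (y + t))"
  by (induction n) (auto simp: average_translate)

lemma average_iter_diff:
  assumes "h \<in> bounded_borel C" "k \<in> bounded_borel D"
  shows "(average M ^^ n) (\<lambda>x. h x - k x) = (\<lambda>y. (average M ^^ n) h y - (average M ^^ n) k y)"
  by (induction n)
     (auto simp: average_diff[OF average_iter_bounded_borel[OF assms(1)]
                              average_iter_bounded_borel[OF assms(2)]])

lemma average_iter_uminus:
  "(average M ^^ n) (\<lambda>x. - h x) = (\<lambda>y. - (average M ^^ n) h y)"
  by (induction n) (auto simp: average_def)

end

section \<open>Random walks forget small translations\<close>

text \<open>
  The measure \<open>\<nu>\<close> dominates \<open>c\<close> times the translate of \<open>\<rho>\<close> by \<open>t\<close>. The domination is expressed through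
  the averaging operators, where it is used.
\<close>

definition minorised :: "real measure \<Rightarrow> real measure \<Rightarrow> real \<Rightarrow> real \<Rightarrow> bool" where
  "minorised \<nu> \<rho> c t \<longleftrightarrow>
     (\<forall>h C y. h \<in> bounded_borel C \<longrightarrow> (\<forall>x. 0 \<le> h x) \<longrightarrow> c * average \<rho> h (y + t) \<le> average \<nu> h y)"

lemma average_le_of_minorised:
  assumes \<nu>: "real_distribution \<nu>" and \<rho>: "real_distribution \<rho>"
    and minor: "minorised \<nu> \<rho> c t"
    and h: "h \<in> bounded_borel C" and le: "\<And>x. h x \<le> G"
  shows "average \<nu> h y \<le> c * average \<rho> h (y + t) + (1 - c) * G"
proof -
  interpret \<nu>: real_distribution \<nu> by (rule \<nu>)
  interpret \<rho>: real_distribution \<rho> by (rule \<rho>)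
  have G: "(\<lambda>x. G) \<in> bounded_borel \<bar>G\<bar>"
    by (simp add: bounded_borel_def)
  have "c * average \<rho> (\<lambda>x. G - h x) (y + t) \<le> average \<nu> (\<lambda>x. G - h x) y"
    using minor[unfolded minorised_def, rule_format, OF bounded_borel_diff[OF G h]] le by simp
  then show ?thesis
    unfolding \<rho>.average_diff[OF G h] \<nu>.average_diff[OF G h] \<rho>.average_const \<nu>.average_const
    by (simp add: algebra_simps)
qed

text \<open>
  Suppose that each step can place a portion \<open>c\<close> of its mass either at \<open>\<rho>\<close> or at \<open>\<rho>\<close> translated by \<open>t\<close>.
  Then \<open>j\<close> steps can place the portion \<open>c ^ j\<close> of their mass at the \<open>j\<close>-th convolution power of \<open>\<rho>\<close>
  translated by \<open>i * t\<close>, for any chosen \<open>i \<le> j\<close>: take the translated portion in \<open>i\<close> of the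
  steps. The rest of the mass contributes at most the upper bound \<open>G\<close> of the function.
\<close>

lemma average_iter_le_of_minorised:
  assumes \<nu>: "real_distribution \<nu>" and \<rho>: "real_distribution \<rho>"
    and c: "0 \<le> c" and minor0: "minorised \<nu> \<rho> c 0" and minor: "minorised \<nu> \<rho> c t"
    and h: "h \<in> bounded_borel C" and le: "\<And>x. h x \<le> G"
    and "i \<le> j"
  shows "(average \<nu> ^^ j) h y \<le> c ^ j * (average \<rho> ^^ j) h (y + real i * t) + (1 - c ^ j) * G"
  using \<open>i \<le> j\<close>
proof (induction j arbitrary: i y)
  case 0
  then show ?case by simp
next
  case (Suc j)
  interpret \<nu>: real_distribution \<nu> by (rule \<nu>)
  interpret \<rho>: real_distribution \<rho> by (rule \<rho>)
  let ?u = "(average \<nu> ^^ j) h" and ?r = "(average \<rho> ^^ j) h"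
  have u: "?u \<in> bounded_borel C" and r: "?r \<in> bounded_borel C"
    using h by (auto intro: \<nu>.average_iter_bounded_borel \<rho>.average_iter_bounded_borel)
  have u_le: "?u x \<le> G" for x
  proof -
    have "?u x \<le> (average \<nu> ^^ j) (\<lambda>x. G) x"
    proof (induction j arbitrary: x)
      case (Suc j)
      have "(\<lambda>x. G) \<in> bounded_borel \<bar>G\<bar>"
        by (simp add: bounded_borel_def)
      then show ?case
        using Suc h
        by (auto intro!: \<nu>.average_mono intro: \<nu>.average_iter_bounded_borel)
    qed (use le in auto)
    also have "(average \<nu> ^^ j) (\<lambda>x. G) x = G"
      by (induction j arbitrary: x) (auto simp: average_def \<nu>.prob_UNIV)
    finally show ?thesis .
  qed
  \<comment> \<open>The first step uses up one of the \<open>i\<close> translations if there is any; the remaining \<open>i'\<close> of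
    them are left to the other \<open>j\<close> steps.\<close>
  define e i' where "e = (if i = 0 then 0 else t)" and "i' = i - 1"
  have i': "i' \<le> j" and e_i': "e + real i' * t = real i * t"
    using Suc.prems by (auto simp: e_def i'_def of_nat_diff algebra_simps)
  have me: "minorised \<nu> \<rho> c e"
    using minor0 minor by (simp add: e_def)
  let ?w = "\<lambda>x. c ^ j * ?r (x + real i' * t) + (1 - c ^ j) * G"
  have [measurable]: "?r \<in> borel_measurable borel"
    using r by (rule bounded_borelD)
  have w: "?w \<in> bounded_borel (c ^ j * C + \<bar>(1 - c ^ j) * G\<bar>)"
    unfolding bounded_borel_def
  proof (intro CollectI conjI allI)
    fix x
    have "\<bar>c ^ j * ?r (x + real i' * t)\<bar> \<le> c ^ j * C"
      using bounded_borelD(2)[OF r] c by (simp add: abs_mult mult_left_mono)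
    then show "\<bar>?w x\<bar> \<le> c ^ j * C + \<bar>(1 - c ^ j) * G\<bar>"
      by linarith
  qed measurable
  have "average \<nu> ?u y \<le> c * average \<rho> ?u (y + e) + (1 - c) * G"
    by (rule average_le_of_minorised[OF \<nu> \<rho> me u u_le])
  also have "\<dots> \<le> c * average \<rho> ?w (y + e) + (1 - c) * G"
    using Suc.IH[OF i'] by (intro add_right_mono mult_left_mono[OF _ c] \<rho>.average_mono[OF u w])
  also have "average \<rho> ?w (y + e) = c ^ j * average \<rho> ?r (y + e + real i' * t) + (1 - c ^ j) * G"
    by (rule \<rho>.average_affine[OF r])
  also have "y + e + real i' * t = y + real i * t"
    using e_i' by simp
  finally show ?case
    by (simp add: algebra_simps)
qed

text \<open>
  This is twice the total variation distance between the law of \<open>n\<close> steps and its translate by \<open>t\<close>.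
\<close>

definition shift_gap :: "real measure \<Rightarrow> real \<Rightarrow> nat \<Rightarrow> real" where
  "shift_gap \<nu> t n = (SUP (h, y) \<in> bounded_borel 1 \<times> UNIV.
     (average \<nu> ^^ n) h y - (average \<nu> ^^ n) h (y + t))"

context real_distribution
begin

lemma shift_gap_upper_one_sided:
  assumes "h \<in> bounded_borel 1"
  shows "(average M ^^ n) h y - (average M ^^ n) h (y + t) \<le> shift_gap M t n"
proof -
  let ?D = "\<lambda>(h, y). (average M ^^ n) h y - (average M ^^ n) h (y + t)"
  have "?D p \<le> 2" if p: "p \<in> bounded_borel 1 \<times> UNIV" for p
  proof -
    obtain k z where [simp]: "p = (k, z)" and k: "k \<in> bounded_borel 1"
      using p by auto
    show ?thesis
      using bounded_borelD(2)[OF average_iter_bounded_borel[OF k], of n z]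
            bounded_borelD(2)[OF average_iter_bounded_borel[OF k], of n "z + t"]
      by simp
  qed
  then have "bdd_above (?D ` (bounded_borel 1 \<times> UNIV))"
    by (intro bdd_aboveI2)
  from cSUP_upper[OF _ this, of "(h, y)"] show ?thesis
    using assms by (simp add: shift_gap_def)
qed

lemma shift_gap_upper:
  assumes "h \<in> bounded_borel 1"
  shows "\<bar>(average M ^^ n) h y - (average M ^^ n) h (y + t)\<bar> \<le> shift_gap M t n"
  using shift_gap_upper_one_sided[OF assms, of n y t]
        shift_gap_upper_one_sided[OF bounded_borel_uminus[OF assms], of n y t]
  by (simp add: average_iter_uminus)

lemma shift_gap_nonneg: "0 \<le> shift_gap M t n"
  using shift_gap_upper[of "\<lambda>x. 0" n 0 t] by (simp add: bounded_borel_def)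

lemma shift_gap_least:
  assumes "\<And>h y. h \<in> bounded_borel 1 \<Longrightarrow> (average M ^^ n) h y - (average M ^^ n) h (y + t) \<le> K"
  shows "shift_gap M t n \<le> K"
proof -
  have "(\<lambda>x. 0) \<in> bounded_borel 1"
    by (simp add: bounded_borel_def)
  then show ?thesis
    unfolding shift_gap_def using assms by (intro cSUP_least) auto
qed

lemma shift_gap_decseq: "decseq (shift_gap M t)"
proof (rule decseq_SucI, rule shift_gap_least)
  fix n h y
  assume "h \<in> bounded_borel 1"
  from shift_gap_upper_one_sided[OF average_bounded_borel[OF this], of n y t]
  show "(average M ^^ Suc n) h y - (average M ^^ Suc n) h (y + t) \<le> shift_gap M t n"
    by (simp only: funpow_Suc_right o_apply)
qed

end

text \<open>
  Let \<open>k\<close> be the result of \<open>n\<close> steps applied to a test function and let \<open>g\<close> be the difference of \<open>k\<close>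
  and its translate, so that \<open>g\<close> is at most the gap at \<open>n\<close>. For each \<open>i \<le> j\<close>, the minorisation
  bounds the result of \<open>j\<close> further steps on \<open>g\<close> at \<open>y\<close> through the value of an average of \<open>g\<close> at
  \<open>y + i * t\<close>. Adding the \<open>j + 1\<close> bounds makes these values telescope to a difference of two values of an
  average of \<open>k\<close>, which is at most \<open>2\<close> however large \<open>j\<close> is.
\<close>

lemma shift_gap_recurrence:
  assumes \<nu>: "real_distribution \<nu>" and \<rho>: "real_distribution \<rho>"
    and c: "0 \<le> c" and minor0: "minorised \<nu> \<rho> c 0" and minor: "minorised \<nu> \<rho> c t"
  shows "real (Suc j) * shift_gap \<nu> t (n + j)
           \<le> 2 * c ^ j + real (Suc j) * ((1 - c ^ j) * shift_gap \<nu> t n)"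
proof -
  interpret \<nu>: real_distribution \<nu> by (rule \<nu>)
  interpret \<rho>: real_distribution \<rho> by (rule \<rho>)
  let ?G = "shift_gap \<nu> t n"
  have "(average \<nu> ^^ (n + j)) h y - (average \<nu> ^^ (n + j)) h (y + t)
          \<le> (2 * c ^ j + real (Suc j) * ((1 - c ^ j) * ?G)) / real (Suc j)"
    if h: "h \<in> bounded_borel 1" for h y
  proof -
    define k where "k = (average \<nu> ^^ n) h"
    define g where "g = (\<lambda>x. k x - k (x + t))"
    define r where "r = (average \<rho> ^^ j) k"
    have k: "k \<in> bounded_borel 1"
      unfolding k_def by (rule \<nu>.average_iter_bounded_borel[OF h])
    have kt: "(\<lambda>x. k (x + t)) \<in> bounded_borel 1"
      by (rule bounded_borel_translate[OF k])
    have g: "g \<in> bounded_borel (1 + 1)"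
      unfolding g_def by (rule bounded_borel_diff[OF k kt])
    have g_le: "g x \<le> ?G" for x
      unfolding g_def k_def by (rule \<nu>.shift_gap_upper_one_sided[OF h])
    have gap: "(average \<nu> ^^ (n + j)) h y - (average \<nu> ^^ (n + j)) h (y + t) = (average \<nu> ^^ j) g y"
    proof -
      have "(average \<nu> ^^ (n + j)) h = (average \<nu> ^^ j) k"
        by (simp add: k_def add.commute[of n j] funpow_add)
      then show ?thesis
        unfolding g_def \<nu>.average_iter_diff[OF k kt] \<nu>.average_iter_translate by simp
    qed
    have rg: "(average \<rho> ^^ j) g (y + real i * t) = r (y + real i * t) - r (y + real (Suc i) * t)" for i
      unfolding g_def r_def \<rho>.average_iter_diff[OF k kt] \<rho>.average_iter_translate
      by (simp add: algebra_simps)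
    have "real (Suc j) * (average \<nu> ^^ j) g y = (\<Sum>i\<le>j. (average \<nu> ^^ j) g y)"
      by simp
    also have "\<dots> \<le> (\<Sum>i\<le>j. c ^ j * (average \<rho> ^^ j) g (y + real i * t) + (1 - c ^ j) * ?G)"
      by (intro sum_mono average_iter_le_of_minorised[OF \<nu> \<rho> c minor0 minor g g_le]) auto
    also have "\<dots> = c ^ j * (\<Sum>i\<le>j. r (y + real i * t) - r (y + real (Suc i) * t))
                    + real (Suc j) * ((1 - c ^ j) * ?G)"
      by (simp only: rg sum.distrib sum_distrib_left sum_constant card_atMost)
    also have "(\<Sum>i\<le>j. r (y + real i * t) - r (y + real (Suc i) * t)) = r y - r (y + real (Suc j) * t)"
      by (induction j) (auto simp: algebra_simps)
    finally have sum_le: "real (Suc j) * (average \<nu> ^^ j) g y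
      \<le> c ^ j * (r y - r (y + real (Suc j) * t)) + real (Suc j) * ((1 - c ^ j) * ?G)" .
    have "r y - r (y + real (Suc j) * t) \<le> 2"
      using bounded_borelD(2)[OF \<rho>.average_iter_bounded_borel[OF k, of j], of y]
            bounded_borelD(2)[OF \<rho>.average_iter_bounded_borel[OF k, of j], of "y + real (Suc j) * t"]
      unfolding r_def by linarith
    then have "c ^ j * (r y - r (y + real (Suc j) * t)) \<le> c ^ j * 2"
      using c by (intro mult_left_mono) auto
    with sum_le show ?thesis
      unfolding gap by (simp add: field_simps)
  qed
  from \<nu>.shift_gap_least[OF this] show ?thesis
    by (simp add: field_simps)
qed

text \<open>
  The gap decreases to a limit \<open>G\<close>. Letting \<open>n\<close> tend to infinity in the recurrence, the term
  \<open>(j + 1) * G\<close> cancels on both sides and leaves \<open>(j + 1) * c ^ j * G \<le> 2 * c ^ j\<close>. The factor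
  \<open>c ^ j\<close> cancels too, so \<open>G \<le> 2 / (j + 1)\<close> for every \<open>j\<close>.
\<close>

lemma shift_gap_tendsto_0:
  assumes \<nu>: "real_distribution \<nu>" and \<rho>: "real_distribution \<rho>"
    and c: "0 < c" and minor0: "minorised \<nu> \<rho> c 0" and minor: "minorised \<nu> \<rho> c t"
  shows "shift_gap \<nu> t \<longlonglongrightarrow> 0"
proof -
  interpret \<nu>: real_distribution \<nu> by (rule \<nu>)
  obtain G where G: "shift_gap \<nu> t \<longlonglongrightarrow> G" and Gn: "\<And>n. G \<le> shift_gap \<nu> t n"
    using decseq_convergent[OF \<nu>.shift_gap_decseq, of 0 t] \<nu>.shift_gap_nonneg by blast
  have "G \<le> 2 / real (Suc j)" for j
  proof -
    have "real (Suc j) * G \<le> 2 * c ^ j + real (Suc j) * ((1 - c ^ j) * G)"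
    proof (rule LIMSEQ_le)
      show "(\<lambda>n. real (Suc j) * shift_gap \<nu> t (n + j)) \<longlonglongrightarrow> real (Suc j) * G"
        by (intro tendsto_intros LIMSEQ_ignore_initial_segment[OF G])
      show "(\<lambda>n. 2 * c ^ j + real (Suc j) * ((1 - c ^ j) * shift_gap \<nu> t n))
              \<longlonglongrightarrow> 2 * c ^ j + real (Suc j) * ((1 - c ^ j) * G)"
        by (intro tendsto_intros G)
      show "\<exists>N. \<forall>n\<ge>N. real (Suc j) * shift_gap \<nu> t (n + j)
              \<le> 2 * c ^ j + real (Suc j) * ((1 - c ^ j) * shift_gap \<nu> t n)"
        using shift_gap_recurrence[OF \<nu> \<rho> _ minor0 minor] c by auto
    qed
    then have "c ^ j * (real (Suc j) * G) \<le> c ^ j * 2"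
      by (simp add: algebra_simps)
    then have "real (Suc j) * G \<le> 2"
      using c by (subst (asm) mult_le_cancel_left_pos) auto
    then show ?thesis
      by (simp add: field_simps)
  qed
  moreover have "(\<lambda>j. 2 / real (Suc j)) \<longlonglongrightarrow> 0"
    using tendsto_mult_right_zero[OF LIMSEQ_inverse_real_of_nat, of 2]
    by (simp add: divide_inverse)
  ultimately have "G \<le> 0"
    by (intro LIMSEQ_le_const) auto
  moreover have "0 \<le> G"
    by (rule LIMSEQ_le_const[OF G]) (use \<nu>.shift_gap_nonneg in auto)
  ultimately show ?thesis
    using G by simp
qed

section \<open>Minorisation from a continuous density\<close>

text \<open>
  If the density is at least \<open>e\<close> on an interval of length \<open>2 * w\<close>, then the uniform distribution on
  the left half and all its translates by at most \<open>w\<close> live where the density is at least \<open>e\<close>.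
\<close>

lemma minorised_density_lborel:
  fixes f :: "real \<Rightarrow> real"
  assumes f[measurable]: "f \<in> borel_measurable borel" and f0: "\<And>x. 0 \<le> f x"
    and \<nu>: "real_distribution (density lborel (\<lambda>x. ennreal (f x)))"
    and e: "0 \<le> e" and w: "0 < w" and lower: "\<And>x. u \<le> x \<Longrightarrow> x \<le> u + 2 * w \<Longrightarrow> e \<le> f x"
    and t: "0 \<le> t" "t \<le> w"
  shows "minorised (density lborel (\<lambda>x. ennreal (f x)))
           (density lborel (\<lambda>x. ennreal (indicator {u..u + w} x / w))) (e * w) t"
  unfolding minorised_def
proof (intro allI impI)
  fix h :: "real \<Rightarrow> real" and C y
  assume h: "h \<in> bounded_borel C" and h0: "\<forall>x. 0 \<le> h x"
  have [measurable]: "h \<in> borel_measurable borel"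
    by (rule bounded_borelD[OF h])
  interpret \<nu>: real_distribution "density lborel (\<lambda>x. ennreal (f x))" by (rule \<nu>)
  have fh: "integrable lborel (\<lambda>x. f x * h (y + x))"
    using \<nu>.integrable_bounded_borel[OF h, of y] f0 by (simp add: integrable_density)
  have "e * w * average (density lborel (\<lambda>x. ennreal (indicator {u..u + w} x / w))) h (y + t)
          = e * w * (\<integral>x. (indicator {u..u + w} x / w) * h (y + t + x) \<partial>lborel)"
    unfolding average_def using w by (subst integral_density) auto
  also have "\<dots> = (\<integral>x. e * indicator {u..u + w} x * h (y + t + x) \<partial>lborel)"
    using w by (subst Bochner_Integration.integral_mult_right_zero[symmetric])
      (auto simp: field_simps intro!: Bochner_Integration.integral_cong)
  also have "\<dots> = (\<integral>x. e * indicator {u + t..u + t + w} x * h (y + x) \<partial>lborel)"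
    by (subst (2) lborel_integral_real_affine[where c = 1 and t = t])
      (auto simp: ac_simps indicator_def intro!: Bochner_Integration.integral_cong)
  also have "\<dots> \<le> (\<integral>x. f x * h (y + x) \<partial>lborel)"
  proof (rule integral_mono')
    fix x
    show "e * indicator {u + t..u + t + w} x * h (y + x) \<le> f x * h (y + x)"
      using h0 f0 lower[of x] t by (intro mult_right_mono) (auto simp: indicator_def)
    show "0 \<le> f x * h (y + x)"
      using h0 f0 by simp
  qed (rule fh)
  also have "\<dots> = average (density lborel (\<lambda>x. ennreal (f x))) h y"
    unfolding average_def using f0 by (subst integral_density) auto
  finally show "e * w * average (density lborel (\<lambda>x. ennreal (indicator {u..u + w} x / w))) h (y + t)
                  \<le> average (density lborel (\<lambda>x. ennreal (f x))) h y" .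
qed

lemma real_distribution_uniform:
  assumes "0 < w"
  shows "real_distribution (density lborel (\<lambda>x. ennreal (indicator {u..u + w} x / w)))"
proof -
  have "emeasure (density lborel (\<lambda>x. ennreal (indicator {u..u + w} x / w))) UNIV
          = (\<integral>\<^sup>+x. ennreal (1 / w) * indicator {u..u + w} x \<partial>lborel)"
    by (subst emeasure_density)
       (auto intro!: nn_integral_cong simp: indicator_def)
  also have "\<dots> = ennreal (1 / w) * ennreal w"
    using assms by (subst nn_integral_cmult_indicator) auto
  also have "\<dots> = 1"
    using assms by (simp flip: ennreal_mult)
  finally have "prob_space (density lborel (\<lambda>x. ennreal (indicator {u..u + w} x / w)))"
    by (intro prob_spaceI) simp
  then show ?thesis
    by (simp add: real_distribution_def real_distribution_axioms_def)
qed

text \<open>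
  A continuous density is bounded below by a positive constant near a point where it is positive, which
  yields the minorisation for all small translations at once.
\<close>

lemma shift_gap_density_tendsto_0:
  fixes f :: "real \<Rightarrow> real"
  assumes cont: "continuous_on UNIV f" and f0: "\<And>x. 0 \<le> f x"
    and \<nu>: "real_distribution (density lborel (\<lambda>x. ennreal (f x)))"
  shows "\<exists>w>0. \<forall>t. 0 \<le> t \<longrightarrow> t \<le> w \<longrightarrow>
           shift_gap (density lborel (\<lambda>x. ennreal (f x))) t \<longlonglongrightarrow> 0"
proof -
  interpret \<nu>: real_distribution "density lborel (\<lambda>x. ennreal (f x))" by (rule \<nu>)
  have [measurable]: "f \<in> borel_measurable borel"
    using cont by (rule borel_measurable_continuous_onI)
  have "\<exists>x. f x \<noteq> 0"
  proof (rule ccontr)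
    assume "\<nexists>x. f x \<noteq> 0"
    then have "emeasure (density lborel (\<lambda>x. ennreal (f x))) UNIV = 0"
      by (simp add: emeasure_density)
    then show False
      using \<nu>.emeasure_space_1 by simp
  qed
  then obtain a where a: "0 < f a"
    using f0 by (metis order_le_less)
  have "isCont f a"
    using cont by (simp add: continuous_on_eq_continuous_at)
  then have "\<forall>\<^sub>F x in at a. f a / 2 < f x"
    using a by (intro order_tendstoD) (auto simp: isCont_def)
  then obtain d where d: "d > 0" and near: "\<And>x. x \<noteq> a \<Longrightarrow> dist x a < d \<Longrightarrow> f a / 2 < f x"
    unfolding eventually_at by auto
  \<comment> \<open>The interval from \<open>a\<close> to \<open>a + 2 * w\<close> has to stay strictly within distance \<open>d\<close> of \<open>a\<close>.\<close>
  define w where "w = d / 4"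
  have w: "0 < w" using d by (simp add: w_def)
  have lower: "f a / 2 \<le> f x" if "a \<le> x" "x \<le> a + 2 * w" for x
    using near[of x] that a d by (cases "x = a") (auto simp: w_def dist_real_def)
  show ?thesis
  proof (intro exI conjI allI impI)
    fix t assume t: "0 \<le> t" "t \<le> w"
    show "shift_gap (density lborel (\<lambda>x. ennreal (f x))) t \<longlonglongrightarrow> 0"
    proof (rule shift_gap_tendsto_0)
      show "real_distribution (density lborel (\<lambda>x. ennreal (indicator {a..a + w} x / w)))"
        by (rule real_distribution_uniform[OF w])
      show "0 < f a / 2 * w"
        using a w by simp
    qed (use minorised_density_lborel[OF _ f0 \<nu> _ w lower] a t w \<nu> in auto)
  qed (rule w)
qed

section \<open>Independent random walks in several coordinates\<close>

context prob_space
begin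

lemma expectation_indep_var:
  assumes ind: "indep_var S U T V"
    and \<phi>[measurable]: "\<phi> \<in> borel_measurable (S \<Otimes>\<^sub>M T)" and bound: "\<And>z. \<bar>\<phi> z\<bar> \<le> (C::real)"
  shows "expectation (\<lambda>\<omega>. \<phi> (U \<omega>, V \<omega>)) = expectation (\<lambda>\<omega>. \<integral>v. \<phi> (U \<omega>, v) \<partial>distr M T V)"
proof -
  have U[measurable]: "random_variable S U" and V[measurable]: "random_variable T V"
    and eq: "distr M S U \<Otimes>\<^sub>M distr M T V = distr M (S \<Otimes>\<^sub>M T) (\<lambda>\<omega>. (U \<omega>, V \<omega>))"
    using ind by (auto simp: indep_var_distribution_eq)
  interpret U: prob_space "distr M S U" by (rule prob_space_distr) fact
  interpret V: prob_space "distr M T V" by (rule prob_space_distr) fact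
  interpret P: pair_prob_space "distr M S U" "distr M T V" ..
  have int: "integrable (distr M S U \<Otimes>\<^sub>M distr M T V) \<phi>"
    using bound by (intro P.integrable_const_bound[where B = C]) auto
  have "expectation (\<lambda>\<omega>. \<phi> (U \<omega>, V \<omega>)) = integral\<^sup>L (distr M (S \<Otimes>\<^sub>M T) (\<lambda>\<omega>. (U \<omega>, V \<omega>))) \<phi>"
    by (subst integral_distr) auto
  also have "\<dots> = (\<integral>u. (\<integral>v. \<phi> (u, v) \<partial>distr M T V) \<partial>distr M S U)"
    unfolding eq[symmetric] by (rule P.integral_fst'[OF int, symmetric])
  also have "\<dots> = expectation (\<lambda>\<omega>. \<integral>v. \<phi> (U \<omega>, v) \<partial>distr M T V)"
    by (subst integral_distr) auto
  finally show ?thesis .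
qed

text \<open>
  Conditioning on the last step and applying the induction hypothesis to the starting point moved by
  that step turns one more step into one more application of the averaging operator.
\<close>

lemma expectation_random_walk:
  fixes L :: "nat \<Rightarrow> 'a \<Rightarrow> real"
  assumes ind: "indep_vars (\<lambda>_. borel) L {1..n}"
    and law: "\<And>j. j \<in> {1..n} \<Longrightarrow> distr M borel (L j) = \<nu>"
    and \<nu>: "real_distribution \<nu>"
    and h: "h \<in> bounded_borel C"
  shows "expectation (\<lambda>\<omega>. h (y + (\<Sum>j\<in>{1..n}. L j \<omega>))) = (average \<nu> ^^ n) h y"
  using assms(1,2)
proof (induction n arbitrary: y)
  case 0
  then show ?case by (simp add: prob_space)
next
  case (Suc n)
  interpret \<nu>: real_distribution \<nu> by (rule \<nu>)
  let ?S = "\<lambda>\<omega>. \<Sum>j\<in>{1..n}. L j \<omega>"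
  have [measurable]: "h \<in> borel_measurable borel"
    by (rule bounded_borelD[OF h])
  have T[measurable]: "(average \<nu> ^^ n) h \<in> borel_measurable borel"
    by (rule bounded_borelD[OF \<nu>.average_iter_bounded_borel[OF h]])
  have iSuc: "{1..Suc n} = insert (Suc n) {1..n}"
    by auto
  have iv: "indep_var borel (L (Suc n)) borel ?S"
    using Suc.prems(1) unfolding iSuc by (intro indep_vars_sum) auto
  then have [measurable]: "random_variable borel (L (Suc n))" and S: "random_variable borel ?S"
    by (auto dest: indep_var_rv1 indep_var_rv2)
  have ind: "indep_vars (\<lambda>_. borel) L {1..n}"
    using Suc.prems(1) by (rule indep_vars_subset) auto
  let ?\<phi> = "\<lambda>(l, s). h (y + l + s)"
  have "expectation (\<lambda>\<omega>. h (y + (\<Sum>j\<in>{1..Suc n}. L j \<omega>))) = expectation (\<lambda>\<omega>. ?\<phi> (L (Suc n) \<omega>, ?S \<omega>))"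
    by (simp add: ac_simps)
  also have "\<dots> = expectation (\<lambda>\<omega>. \<integral>s. ?\<phi> (L (Suc n) \<omega>, s) \<partial>distr M borel ?S)"
    using bounded_borelD(2)[OF h] by (intro expectation_indep_var[OF iv, where C = C]) auto
  also have "(\<lambda>\<omega>. \<integral>s. ?\<phi> (L (Suc n) \<omega>, s) \<partial>distr M borel ?S)
               = (\<lambda>\<omega>. (average \<nu> ^^ n) h (y + L (Suc n) \<omega>))"
  proof
    fix \<omega>
    have "(\<integral>s. ?\<phi> (L (Suc n) \<omega>, s) \<partial>distr M borel ?S)
            = expectation (\<lambda>\<omega>'. h (y + L (Suc n) \<omega> + ?S \<omega>'))"
      by (subst integral_distr[OF S]) auto
    also have "\<dots> = (average \<nu> ^^ n) h (y + L (Suc n) \<omega>)"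
      using Suc.prems(2) by (intro Suc.IH[OF ind]) auto
    finally show "(\<integral>s. ?\<phi> (L (Suc n) \<omega>, s) \<partial>distr M borel ?S)
                    = (average \<nu> ^^ n) h (y + L (Suc n) \<omega>)" .
  qed
  also have "expectation (\<lambda>\<omega>. (average \<nu> ^^ n) h (y + L (Suc n) \<omega>))
               = (\<integral>l. (average \<nu> ^^ n) h (y + l) \<partial>distr M borel (L (Suc n)))"
    by (subst integral_distr) auto
  also have "\<dots> = (average \<nu> ^^ Suc n) h y"
    using Suc.prems(2)[of "Suc n"] by (simp add: average_def)
  finally show ?case .
qed

end

lemma borel_measurable_vec_lambda:
  fixes F :: "'m::finite \<Rightarrow> 'a \<Rightarrow> real"
  assumes "\<And>i. F i \<in> borel_measurable M"
  shows "(\<lambda>x. \<chi> i. F i x) \<in> borel_measurable M"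
  using assms by (subst borel_measurable_euclidean_space) (auto simp: Basis_vec_def inner_axis)

locale random_walks = prob_space M
  for M :: "'w measure" +
  fixes L :: "'m::finite \<Rightarrow> nat \<Rightarrow> 'w \<Rightarrow> real" and \<nu> :: "real measure"
  assumes L_indep: "indep_vars (\<lambda>_. borel) (\<lambda>(i, j). L i j) (UNIV \<times> {1..})"
    and L_law: "\<And>i j. j \<ge> 1 \<Longrightarrow> distr M borel (L i j) = \<nu>"
    and \<nu>: "real_distribution \<nu>"
begin

definition walk :: "real ^ 'm \<Rightarrow> nat \<Rightarrow> 'w \<Rightarrow> real ^ 'm" where
  "walk y n \<omega> = (\<chi> i. y $ i + (\<Sum>j\<in>{1..n}. L i j \<omega>))"

lemma L_measurable: "j \<ge> 1 \<Longrightarrow> L i j \<in> borel_measurable M"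
  using L_indep by (auto simp: indep_vars_def)

lemma walk_measurable[measurable]: "walk y n \<in> borel_measurable M"
  unfolding walk_def using L_measurable
  by (intro borel_measurable_vec_lambda borel_measurable_add borel_measurable_sum) auto

text \<open>
  Given all other coordinates, the expectation over the \<open>i\<close>-th walk is a one-dimensional average, for
  which the definition of the gap gives a bound that is uniform in the other coordinates.
\<close>

lemma expectation_shift_coordinate:
  fixes h :: "real ^ 'm \<Rightarrow> real"
  assumes h[measurable]: "h \<in> borel_measurable borel" and h1: "\<And>x. \<bar>h x\<bar> \<le> 1"
  shows "\<bar>expectation (\<lambda>\<omega>. h (walk y n \<omega>)) - expectation (\<lambda>\<omega>. h (walk y n \<omega> + t *\<^sub>R axis i 1))\<bar>
           \<le> shift_gap \<nu> t n"
proof -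
  interpret \<nu>: real_distribution \<nu> by (rule \<nu>)
  define U where "U \<omega> = (\<chi> k. if k = i then 0 else y $ k + (\<Sum>j\<in>{1..n}. L k j \<omega>))" for \<omega>
  define V where "V \<omega> = (\<Sum>j\<in>{1..n}. L i j \<omega>) *\<^sub>R (axis i 1 :: real ^ 'm)" for \<omega>
  \<comment> \<open>\<open>U\<close> carries the other coordinates and \<open>V\<close> the \<open>i\<close>-th walk. Both take values in the same
    vector space because \<open>indep_var\<close> relates random variables of equal type.\<close>
  have split: "walk y n \<omega> + s *\<^sub>R axis i 1 = U \<omega> + V \<omega> + (y $ i + s) *\<^sub>R axis i 1" for \<omega> s
    by (auto simp: vec_eq_iff walk_def U_def V_def axis_def)
  define A B where "A = (- {i}) \<times> {1..n}" and "B = {i} \<times> {1..n}"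
  let ?R = "\<lambda>K \<omega>. restrict (\<lambda>p. (\<lambda>(i, j). L i j) p \<omega>) K"
  let ?f = "\<lambda>g. \<chi> k. if k = i then 0 else y $ k + (\<Sum>j\<in>{1..n}. g (k, j))"
  let ?g = "\<lambda>g. (\<Sum>j\<in>{1..n}. g (i, j)) *\<^sub>R (axis i 1 :: real ^ 'm)"
  have "indep_var (PiM A (\<lambda>_. borel)) (?R A) (PiM B (\<lambda>_. borel)) (?R B)"
    by (rule indep_var_restrict[OF L_indep]) (auto simp: A_def B_def)
  then have "indep_var borel (?f \<circ> ?R A) borel (?g \<circ> ?R B)"
  proof (rule indep_var_compose)
    show "?f \<in> borel_measurable (PiM A (\<lambda>_. borel))"
    proof (rule borel_measurable_vec_lambda)
      fix k
      show "(\<lambda>g. if k = i then 0 else y $ k + (\<Sum>j\<in>{1..n}. g (k, j)))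
              \<in> borel_measurable (PiM A (\<lambda>_. borel))"
        by (cases "k = i")
           (auto simp: A_def intro!: borel_measurable_add borel_measurable_sum measurable_component_singleton)
    qed
    show "?g \<in> borel_measurable (PiM B (\<lambda>_. borel))"
      by (auto simp: B_def intro!: borel_measurable_scaleR borel_measurable_sum measurable_component_singleton)
  qed
  also have "?f \<circ> ?R A = U"
    by (auto simp: fun_eq_iff vec_eq_iff U_def A_def)
  also have "?g \<circ> ?R B = V"
    by (auto simp: fun_eq_iff V_def B_def)
  finally have UV: "indep_var borel U borel V" .
  then have [measurable]: "U \<in> borel_measurable M" "V \<in> borel_measurable M"
    by (auto dest: indep_var_rv1 indep_var_rv2)
  define k where "k u x = h (u + x *\<^sub>R axis i 1)" for u x
  have "k u \<in> borel_measurable borel" for u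
    unfolding k_def by measurable
  then have k: "k u \<in> bounded_borel 1" for u
    using h1 by (simp add: bounded_borel_def) (simp add: k_def)
  have "indep_vars (\<lambda>j. PiM {(i, j)} (\<lambda>_. borel)) (\<lambda>j. ?R {(i, j)}) {1..n}"
    by (rule indep_vars_restrict[OF L_indep]) (auto simp: disjoint_family_on_def)
  then have "indep_vars (\<lambda>_. borel) (\<lambda>j \<omega>. ?R {(i, j)} \<omega> (i, j)) {1..n}"
    by (rule indep_vars_compose2) (auto intro: measurable_component_singleton)
  then have Li: "indep_vars (\<lambda>_. borel) (L i) {1..n}"
    by (simp add: fun_eq_iff)
  have E: "expectation (\<lambda>\<omega>. h (walk y n \<omega> + s *\<^sub>R axis i 1))
             = expectation (\<lambda>\<omega>. (average \<nu> ^^ n) (k (U \<omega>)) (y $ i + s))"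
    and I: "integrable M (\<lambda>\<omega>. (average \<nu> ^^ n) (k (U \<omega>)) (y $ i + s))" for s
  proof -
    let ?\<phi> = "\<lambda>(u, v). h (u + v + (y $ i + s) *\<^sub>R axis i 1)"
    have inner: "(\<integral>v. ?\<phi> (u, v) \<partial>distr M borel V) = (average \<nu> ^^ n) (k u) (y $ i + s)" for u
    proof -
      have "(\<integral>v. ?\<phi> (u, v) \<partial>distr M borel V)
              = expectation (\<lambda>\<omega>. k u (y $ i + s + (\<Sum>j\<in>{1..n}. L i j \<omega>)))"
        by (subst integral_distr) (auto simp: k_def V_def algebra_simps)
      also have "\<dots> = (average \<nu> ^^ n) (k u) (y $ i + s)"
        using L_law by (intro expectation_random_walk[OF Li _ \<nu> k]) auto
      finally show ?thesis .
    qed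
    have "expectation (\<lambda>\<omega>. h (walk y n \<omega> + s *\<^sub>R axis i 1)) = expectation (\<lambda>\<omega>. ?\<phi> (U \<omega>, V \<omega>))"
      by (simp add: split)
    also have "\<dots> = expectation (\<lambda>\<omega>. \<integral>v. ?\<phi> (U \<omega>, v) \<partial>distr M borel V)"
      using h1 by (intro expectation_indep_var[OF UV, where C = 1]) auto
    finally show "expectation (\<lambda>\<omega>. h (walk y n \<omega> + s *\<^sub>R axis i 1))
             = expectation (\<lambda>\<omega>. (average \<nu> ^^ n) (k (U \<omega>)) (y $ i + s))"
      unfolding inner .
    interpret V: prob_space "distr M borel V" by (rule prob_space_distr) simp
    have "(\<lambda>\<omega>. \<integral>v. ?\<phi> (U \<omega>, v) \<partial>distr M borel V) \<in> borel_measurable M"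
      by measurable
    then show "integrable M (\<lambda>\<omega>. (average \<nu> ^^ n) (k (U \<omega>)) (y $ i + s))"
      using bounded_borelD(2)[OF \<nu>.average_iter_bounded_borel[OF k]] unfolding inner
      by (intro integrable_const_bound[where B = 1]) auto
  qed
  let ?D = "\<lambda>\<omega>. (average \<nu> ^^ n) (k (U \<omega>)) (y $ i) - (average \<nu> ^^ n) (k (U \<omega>)) (y $ i + t)"
  have "\<bar>expectation (\<lambda>\<omega>. h (walk y n \<omega>)) - expectation (\<lambda>\<omega>. h (walk y n \<omega> + t *\<^sub>R axis i 1))\<bar>
          = \<bar>expectation ?D\<bar>"
    using E[of 0] E[of t] I[of 0] I[of t] by simp
  also have "\<dots> \<le> expectation (\<lambda>\<omega>. \<bar>?D \<omega>\<bar>)"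
    by (rule integral_abs_bound)
  also have "\<dots> \<le> expectation (\<lambda>\<omega>. shift_gap \<nu> t n)"
    using I[of 0] I[of t] \<nu>.shift_gap_upper[OF k] by (intro integral_mono) auto
  finally show ?thesis
    by (simp add: prob_space)
qed

text \<open>
  The diagonal translation is a composition of translations of single coordinates, each of which costs
  at most one gap.
\<close>

lemma expectation_shift:
  fixes h :: "real ^ 'm \<Rightarrow> real"
  assumes h: "h \<in> borel_measurable borel" and h1: "\<And>x. \<bar>h x\<bar> \<le> 1"
  shows "\<bar>expectation (\<lambda>\<omega>. h (walk y n \<omega>)) - expectation (\<lambda>\<omega>. h (walk y n \<omega> + (\<chi> i. t)))\<bar>
           \<le> real CARD('m) * shift_gap \<nu> t n"
proof -
  have "\<bar>expectation (\<lambda>\<omega>. h (walk y n \<omega>)) - expectation (\<lambda>\<omega>. h (walk y n \<omega> + (\<Sum>i\<in>J. t *\<^sub>R axis i 1)))\<bar>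
          \<le> real (card J) * shift_gap \<nu> t n" if "finite J" for J :: "'m set"
    using that
  proof (induction J)
    case (insert i J)
    let ?s = "\<Sum>i\<in>J. t *\<^sub>R axis i (1::real)"
    have "\<bar>expectation (\<lambda>\<omega>. h (walk y n \<omega> + ?s))
            - expectation (\<lambda>\<omega>. h (walk y n \<omega> + t *\<^sub>R axis i 1 + ?s))\<bar> \<le> shift_gap \<nu> t n"
      using h h1 by (intro expectation_shift_coordinate[where h = "\<lambda>x. h (x + ?s)"]) auto
    with insert show ?case
      by (simp add: algebra_simps)
  qed simp
  from this[of UNIV] have "\<bar>expectation (\<lambda>\<omega>. h (walk y n \<omega>))
      - expectation (\<lambda>\<omega>. h (walk y n \<omega> + (\<Sum>i\<in>UNIV. t *\<^sub>R axis i 1)))\<bar>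
          \<le> real CARD('m) * shift_gap \<nu> t n"
    by simp
  also have "(\<Sum>i\<in>UNIV. t *\<^sub>R axis i 1) = (\<chi> i. t :: real ^ 'm)"
    by (simp add: vec_eq_iff axis_def if_distrib[of "\<lambda>x. _ * x"] cong: if_cong)
  finally show ?thesis .
qed

end

section \<open>Equidistribution modulo one\<close>

lemma floor_mult_mod_eq_floor_mult_frac:
  assumes "0 < q"
  shows "\<lfloor>real q * z\<rfloor> mod int q = \<lfloor>real q * frac z\<rfloor>"
proof -
  have "real q * z = real_of_int (int q * \<lfloor>z\<rfloor>) + real q * frac z"
    by (simp add: frac_def algebra_simps)
  then have "\<lfloor>real q * z\<rfloor> = int q * \<lfloor>z\<rfloor> + \<lfloor>real q * frac z\<rfloor>"
    by (simp only: int_add_floor)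
  moreover have "0 \<le> \<lfloor>real q * frac z\<rfloor>"
    by simp
  moreover have "\<lfloor>real q * frac z\<rfloor> < int q"
  proof -
    have "real q * frac z < real q * 1"
      using assms frac_lt_1[of z] by (intro mult_strict_left_mono) auto
    then show ?thesis
      by (simp add: floor_less_iff)
  qed
  ultimately show ?thesis
    by (simp add: mod_pos_pos_trivial)
qed

context prob_space
begin

text \<open>
  Here \<open>\<lfloor>q * z\<rfloor> mod q\<close> is the index of the arc of length \<open>1 / q\<close> that contains \<open>z\<close> modulo \<open>1\<close>. The \<open>q\<close>
  probabilities add up to \<open>1\<close>, and neighbouring ones become equal.
\<close>

lemma cell_probability_tendsto:
  assumes Z[measurable]: "\<And>n. Z n \<in> borel_measurable M" and q: "0 < q"
    and step: "\<And>j. Suc j < q \<Longrightarrow>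
        (\<lambda>n. prob {\<omega> \<in> space M. \<lfloor>real q * Z n \<omega>\<rfloor> mod int q = int j}
              - prob {\<omega> \<in> space M. \<lfloor>real q * Z n \<omega>\<rfloor> mod int q = int (Suc j)}) \<longlonglongrightarrow> 0"
    and j: "j < q"
  shows "(\<lambda>n. prob {\<omega> \<in> space M. \<lfloor>real q * Z n \<omega>\<rfloor> mod int q = int j}) \<longlonglongrightarrow> 1 / real q"
proof -
  define p where "p j n = prob {\<omega> \<in> space M. \<lfloor>real q * Z n \<omega>\<rfloor> mod int q = int j}" for j n
  have sum_p: "(\<Sum>j<q. p j n) = 1" for n
  proof -
    have "(\<Sum>j<q. p j n) = prob (\<Union>j<q. {\<omega> \<in> space M. \<lfloor>real q * Z n \<omega>\<rfloor> mod int q = int j})"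
      unfolding p_def
      by (rule finite_measure_finite_Union[symmetric]) (auto simp: disjoint_family_on_def)
    also have "(\<Union>j<q. {\<omega> \<in> space M. \<lfloor>real q * Z n \<omega>\<rfloor> mod int q = int j}) = space M"
    proof (intro equalityI subsetI)
      fix \<omega> assume \<omega>: "\<omega> \<in> space M"
      have "0 \<le> \<lfloor>real q * Z n \<omega>\<rfloor> mod int q" "\<lfloor>real q * Z n \<omega>\<rfloor> mod int q < int q"
        using q by auto
      then show "\<omega> \<in> (\<Union>j<q. {\<omega> \<in> space M. \<lfloor>real q * Z n \<omega>\<rfloor> mod int q = int j})"
        using \<omega> by (auto intro!: bexI[of _ "nat (\<lfloor>real q * Z n \<omega>\<rfloor> mod int q)"])
    qed auto
    finally show ?thesis
      by (simp add: prob_space)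
  qed
  have diff: "(\<lambda>n. p 0 n - p j n) \<longlonglongrightarrow> 0" if "j < q" for j
    using that
  proof (induction j)
    case (Suc j)
    have "(\<lambda>n. (p 0 n - p j n) + (p j n - p (Suc j) n)) \<longlonglongrightarrow> 0 + 0"
      using Suc step[of j] by (intro tendsto_add) (auto simp: p_def)
    then show ?case by simp
  qed simp
  have "(\<lambda>n. (1 + (\<Sum>j<q. p 0 n - p j n)) / real q) \<longlonglongrightarrow> (1 + (\<Sum>j<q. 0)) / real q"
    using q by (intro tendsto_intros diff) auto
  also have "(\<lambda>n. (1 + (\<Sum>j<q. p 0 n - p j n)) / real q) = p 0"
    using q by (simp add: sum_subtractf sum_p fun_eq_iff)
  finally have "(\<lambda>n. p 0 n - (p 0 n - p j n)) \<longlonglongrightarrow> 1 / real q - 0"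
    by (intro tendsto_diff diff j) simp
  then show ?thesis
    by (simp add: p_def)
qed

text \<open>
  The hypothesis says that, for all large \<open>q\<close>, the \<open>q\<close> arcs of length \<open>1 / q\<close> asymptotically receive
  equal probabilities. The event of being at most \<open>a\<close> lies between two unions of such arcs that differ
  by one arc.
\<close>

lemma frac_equidistributed:
  assumes Z[measurable]: "\<And>n. Z n \<in> borel_measurable M"
    and step: "\<And>q j. m \<le> q \<Longrightarrow> Suc j < q \<Longrightarrow>
        (\<lambda>n. prob {\<omega> \<in> space M. \<lfloor>real q * Z n \<omega>\<rfloor> mod int q = int j}
              - prob {\<omega> \<in> space M. \<lfloor>real q * Z n \<omega>\<rfloor> mod int q = int (Suc j)}) \<longlonglongrightarrow> 0"
    and a: "0 \<le> a" "a < 1"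
  shows "(\<lambda>n. prob {\<omega> \<in> space M. frac (Z n \<omega>) \<le> a}) \<longlonglongrightarrow> a"
proof (rule LIMSEQ_I)
  fix r :: real assume r: "0 < r"
  obtain k :: nat where k: "2 / r < real k"
    using reals_Archimedean2 by blast
  define q where "q = max (Suc k) m"
  have q: "0 < q" "m \<le> q" and qr: "2 / real q < r"
  proof -
    have "2 / r < real q"
      using k by (simp add: q_def)
    then show "2 / real q < r"
      using r by (simp add: q_def field_simps)
  qed (auto simp: q_def)
  define p where "p j n = prob {\<omega> \<in> space M. \<lfloor>real q * Z n \<omega>\<rfloor> mod int q = int j}" for j n
  have p: "p j \<longlonglongrightarrow> 1 / real q" if "j < q" for j
    unfolding p_def using cell_probability_tendsto[OF Z q(1) step[OF q(2)] that] by simp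
  have below: "prob {\<omega> \<in> space M. \<lfloor>real q * frac (Z n \<omega>)\<rfloor> < int l} = (\<Sum>j<l. p j n)" for l n
  proof -
    have "{\<omega> \<in> space M. \<lfloor>real q * frac (Z n \<omega>)\<rfloor> < int l}
            = (\<Union>j<l. {\<omega> \<in> space M. \<lfloor>real q * Z n \<omega>\<rfloor> mod int q = int j})"
    proof (intro equalityI subsetI)
      fix \<omega> assume "\<omega> \<in> {\<omega> \<in> space M. \<lfloor>real q * frac (Z n \<omega>)\<rfloor> < int l}"
      moreover from this have "nat \<lfloor>real q * frac (Z n \<omega>)\<rfloor> < l"
        by (subst nat_less_iff) auto
      ultimately show "\<omega> \<in> (\<Union>j<l. {\<omega> \<in> space M. \<lfloor>real q * Z n \<omega>\<rfloor> mod int q = int j})"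
        unfolding floor_mult_mod_eq_floor_mult_frac[OF q(1)]
        by (auto intro!: bexI[of _ "nat \<lfloor>real q * frac (Z n \<omega>)\<rfloor>"])
    qed (auto simp: floor_mult_mod_eq_floor_mult_frac[OF q(1)])
    then show ?thesis
      unfolding p_def
      by (simp, intro finite_measure_finite_Union) (auto simp: disjoint_family_on_def)
  qed
  \<comment> \<open>The point \<open>a\<close> lies in the arc with index \<open>l\<close>.\<close>
  define l where "l = nat \<lfloor>real q * a\<rfloor>"
  have l: "real l \<le> real q * a" "real q * a < real l + 1" and int_l: "int l = \<lfloor>real q * a\<rfloor>"
    using a by (auto simp: l_def)
  have lq: "l < q"
  proof -
    have "real q * a < real q * 1"
      using a q by (intro mult_strict_left_mono) auto
    then show ?thesis using l by simp
  qed
  have [measurable]: "(\<lambda>\<omega>. frac (Z n \<omega>)) \<in> borel_measurable M" for n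
    unfolding frac_def by measurable
  have lower: "(\<Sum>j<l. p j n) \<le> prob {\<omega> \<in> space M. frac (Z n \<omega>) \<le> a}" for n
    unfolding below[symmetric]
  proof (intro finite_measure_mono subsetI CollectI conjI)
    fix \<omega> assume \<omega>: "\<omega> \<in> {\<omega> \<in> space M. \<lfloor>real q * frac (Z n \<omega>)\<rfloor> < int l}"
    then have "real q * frac (Z n \<omega>) < real q * a"
      using l by (auto simp: floor_less_iff)
    then show "frac (Z n \<omega>) \<le> a"
      using q by simp
  qed auto
  have upper: "prob {\<omega> \<in> space M. frac (Z n \<omega>) \<le> a} \<le> (\<Sum>j<Suc l. p j n)" for n
    unfolding below[symmetric]
  proof (intro finite_measure_mono subsetI CollectI conjI)
    fix \<omega> assume \<omega>: "\<omega> \<in> {\<omega> \<in> space M. frac (Z n \<omega>) \<le> a}"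
    then have "real q * frac (Z n \<omega>) \<le> real q * a"
      by (auto intro: mult_left_mono)
    then show "\<lfloor>real q * frac (Z n \<omega>)\<rfloor> < int (Suc l)"
      using l by (auto simp: floor_less_iff)
  qed auto
  have "(\<lambda>n. \<Sum>j<l. p j n) \<longlonglongrightarrow> (\<Sum>j<l. 1 / real q)"
    using lq by (intro tendsto_sum p) auto
  moreover have "a - r < (\<Sum>j<l. 1 / real q)"
  proof -
    have "a < (real l + 1) / real q"
      using l q by (simp add: pos_less_divide_eq mult.commute)
    also have "\<dots> \<le> (real l + 2) / real q"
      by (intro divide_right_mono) auto
    finally show ?thesis using qr by (simp add: add_divide_distrib)
  qed
  ultimately have ev1: "\<forall>\<^sub>F n in sequentially. a - r < (\<Sum>j<l. p j n)"
    by (rule order_tendstoD)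
  have "(\<lambda>n. \<Sum>j<Suc l. p j n) \<longlonglongrightarrow> (\<Sum>j<Suc l. 1 / real q)"
    using lq by (intro tendsto_sum p) auto
  moreover have "(\<Sum>j<Suc l. 1 / real q) < a + r"
  proof -
    have "real l / real q \<le> a"
      using l q by (simp add: pos_divide_le_eq mult.commute)
    moreover have "1 / real q \<le> 2 / real q"
      by (intro divide_right_mono) auto
    ultimately show ?thesis using qr by (simp add: add_divide_distrib)
  qed
  ultimately have "\<forall>\<^sub>F n in sequentially. (\<Sum>j<Suc l. p j n) < a + r"
    by (rule order_tendstoD)
  with ev1 have "\<forall>\<^sub>F n in sequentially. norm (prob {\<omega> \<in> space M. frac (Z n \<omega>) \<le> a} - a) < r"
  proof eventually_elim
    case (elim n)
    then show ?case
      using lower[of n] upper[of n] by (simp add: abs_less_iff)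
  qed
  then show "\<exists>no. \<forall>n\<ge>no. norm (prob {\<omega> \<in> space M. frac (Z n \<omega>) \<le> a} - a) < r"
    by (simp add: eventually_sequentially)
qed

end

context random_walks
begin

text \<open>
  A diagonal translation by \<open>1 / (d * q)\<close> moves each arc of length \<open>1 / q\<close> to the next one.
\<close>

lemma frac_equivariant_equidistributed:
  fixes F :: "real ^ 'm \<Rightarrow> real"
  assumes F[measurable]: "F \<in> borel_measurable borel"
    and equivariant: "\<And>x t. F (x + (\<chi> i. t)) = F x + d * t" and d: "0 < d"
    and w: "0 < w" and gap: "\<And>t. 0 \<le> t \<Longrightarrow> t \<le> w \<Longrightarrow> shift_gap \<nu> t \<longlonglongrightarrow> 0"
    and a: "0 \<le> a" "a < 1"
  shows "(\<lambda>n. prob {\<omega> \<in> space M. frac (F (walk y n \<omega>)) \<le> a}) \<longlonglongrightarrow> a"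
proof -
  obtain m :: nat where m: "1 / (d * w) < real m"
    using reals_Archimedean2 by blast
  show ?thesis
  proof (rule frac_equidistributed[where m = "Suc m"])
    fix q j :: nat assume q: "Suc m \<le> q" and j: "Suc j < q"
    define t where "t = 1 / (d * real q)"
    have "1 / (d * w) < real q"
      using m q by simp
    then have t: "0 \<le> t" "t \<le> w"
      using d w q by (auto simp: t_def field_simps)
    have qt: "real q * (d * t) = 1"
      using d q by (simp add: t_def)
    define c where "c x = \<lfloor>real q * F x\<rfloor> mod int q" for x
    have c_shift: "c (x + (\<chi> i. t)) = (c x + 1) mod int q" for x
    proof -
      have "real q * F (x + (\<chi> i. t)) = real q * F x + 1"
        using qt by (simp add: equivariant distrib_left)
      then show ?thesis
        by (simp add: c_def mod_add_left_eq)
    qed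
    have c_range: "0 \<le> c x" "c x < int q" for x
      using q by (auto simp: c_def)
    define h :: "real ^ 'm \<Rightarrow> real" where "h x = of_bool (c x = int (Suc j))" for x
    have c_meas[measurable]: "c \<in> measurable borel (count_space UNIV)"
      unfolding c_def by measurable
    have h_meas: "h \<in> borel_measurable borel"
      unfolding h_def by measurable
    have h_shift: "h (x + (\<chi> i. t)) = of_bool (c x = int j)" for x
    proof -
      have "(c x + 1) mod int q = int (Suc j) \<longleftrightarrow> c x = int j"
      proof (cases "c x + 1 = int q")
        case False
        then have "(c x + 1) mod int q = c x + 1"
          using c_range[of x] by (intro mod_pos_pos_trivial) auto
        then show ?thesis by auto
      qed (use j in auto)
      then show ?thesis
        by (simp add: h_def c_shift)
    qed
    have E: "expectation (\<lambda>\<omega>. of_bool (c (walk y n \<omega>) = i)) = prob {\<omega> \<in> space M. c (walk y n \<omega>) = i}"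
      for n and i :: int
    proof -
      have "expectation (\<lambda>\<omega>. of_bool (c (walk y n \<omega>) = i))
              = expectation (indicator {\<omega> \<in> space M. c (walk y n \<omega>) = i})"
        by (intro Bochner_Integration.integral_cong) (auto simp: indicator_def)
      also have "\<dots> = prob ({\<omega> \<in> space M. c (walk y n \<omega>) = i} \<inter> space M)"
        by (rule Bochner_Integration.integral_indicator)
      also have "{\<omega> \<in> space M. c (walk y n \<omega>) = i} \<inter> space M = {\<omega> \<in> space M. c (walk y n \<omega>) = i}"
        by auto
      finally show ?thesis .
    qed
    have bound: "\<bar>prob {\<omega> \<in> space M. c (walk y n \<omega>) = int j} - prob {\<omega> \<in> space M. c (walk y n \<omega>) = int (Suc j)}\<bar>
            \<le> real CARD('m) * shift_gap \<nu> t n" for n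
      using expectation_shift[OF h_meas, of y n t]
      unfolding h_shift E by (simp add: h_def E abs_minus_commute)
    have lim: "(\<lambda>n. real CARD('m) * shift_gap \<nu> t n) \<longlonglongrightarrow> 0"
      using tendsto_mult_right_zero[OF gap[OF t]] by simp
    show "(\<lambda>n. prob {\<omega> \<in> space M. \<lfloor>real q * F (walk y n \<omega>)\<rfloor> mod int q = int j}
        - prob {\<omega> \<in> space M. \<lfloor>real q * F (walk y n \<omega>)\<rfloor> mod int q = int (Suc j)}) \<longlonglongrightarrow> 0"
    proof (rule Lim_null_comparison[OF always_eventually lim], rule allI)
      show "norm (prob {\<omega> \<in> space M. \<lfloor>real q * F (walk y n \<omega>)\<rfloor> mod int q = int j}
        - prob {\<omega> \<in> space M. \<lfloor>real q * F (walk y n \<omega>)\<rfloor> mod int q = int (Suc j)})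
          \<le> real CARD('m) * shift_gap \<nu> t n" for n
        using bound[of n] by (simp only: c_def real_norm_def)
    qed
  next
    show "(\<lambda>\<omega>. F (walk y n \<omega>)) \<in> borel_measurable M" for n
      by measurable
  qed (rule a)+
qed

end

section \<open>Homogeneous functions of the side lengths\<close>

lemma significand_eq_powr_frac:
  assumes b: "1 < b" and x: "0 < x"
  shows "significand b x = b powr frac (log b x)"
  unfolding significand_def
proof (rule the1_equality[OF significand_unique[OF assms]], intro conjI exI[of _ "\<lfloor>log b x\<rfloor>"])
  show "1 \<le> b powr frac (log b x)"
    using b by (simp add: ge_one_powr_ge_zero)
  have "b powr frac (log b x) < b powr 1"
    using b frac_lt_1 by (intro powr_less_mono) auto
  then show "b powr frac (log b x) < b"
    using b by simp
  have "b powr frac (log b x) * b powi \<lfloor>log b x\<rfloor> = b powr (frac (log b x) + real_of_int \<lfloor>log b x\<rfloor>)"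
    using b by (simp add: powr_add powr_real_of_int')
  also have "\<dots> = x"
    using b x by (simp add: frac_def)
  finally show "x = b powr frac (log b x) * b powi \<lfloor>log b x\<rfloor>" ..
qed

lemma significand_le_iff:
  assumes "1 < b" "0 < x" "1 \<le> s"
  shows "significand b x \<le> s \<longleftrightarrow> frac (log b x) \<le> log b s"
  using assms by (simp add: significand_eq_powr_frac le_log_iff)

text \<open>
  The maximum product and the \<open>d\<close>-volume of a box as functions of the vector of its side lengths; on
  vectors, scaling and measurability are accessible without going through sets.
\<close>

definition prod_max :: "nat \<Rightarrow> real ^ 'm \<Rightarrow> real" where
  "prod_max d s = Max ((\<lambda>I. \<Prod>i\<in>I. s $ i) ` {I. card I = d})"

definition prod_sum :: "nat \<Rightarrow> real ^ 'm \<Rightarrow> real" where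
  "prod_sum d s = 2 ^ (CARD('m) - d) * (\<Sum>I | card I = d. \<Prod>i\<in>I. s $ i)"

lemma ex_subset_card:
  assumes "d \<le> CARD('m)"
  shows "{I :: 'm::finite set. card I = d} \<noteq> {}"
  using obtain_subset_with_card_n[OF assms] by blast

lemma prod_max_pos:
  fixes s :: "real ^ 'm"
  assumes "d \<le> CARD('m)" "\<And>i. 0 < s $ i"
  shows "0 < prod_max d s"
proof -
  have "prod_max d s \<in> (\<lambda>I. \<Prod>i\<in>I. s $ i) ` {I. card I = d}"
    unfolding prod_max_def using ex_subset_card[OF assms(1)] by (intro Max_in) auto
  moreover have "0 < (\<Prod>i\<in>I. s $ i)" for I
    using assms(2) by (intro prod_pos) auto
  ultimately show ?thesis
    by auto
qed

lemma prod_max_scale: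
  fixes s :: "real ^ 'm"
  assumes "d \<le> CARD('m)" "0 < c"
  shows "prod_max d (c *\<^sub>R s) = c ^ d * prod_max d s"
proof -
  have "prod_max d (c *\<^sub>R s) = Max ((\<lambda>x. c ^ d * x) ` (\<lambda>I. \<Prod>i\<in>I. s $ i) ` {I. card I = d})"
    unfolding prod_max_def image_image
    by (intro arg_cong[where f = Max] image_cong) (auto simp: prod.distrib)
  also have "\<dots> = c ^ d * prod_max d s"
    unfolding prod_max_def using assms ex_subset_card[OF assms(1)]
    by (subst mono_Max_commute[symmetric, where f = "\<lambda>x. c ^ d * x"])
       (auto intro!: monoI mult_left_mono)
  finally show ?thesis .
qed

lemma prod_max_measurable: "prod_max d \<in> borel_measurable borel"
  unfolding prod_max_def[abs_def]
  by (intro borel_measurable_Max borel_measurable_prod) auto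

lemma prod_sum_pos:
  fixes s :: "real ^ 'm"
  assumes "d \<le> CARD('m)" "\<And>i. 0 < s $ i"
  shows "0 < prod_sum d s"
  unfolding prod_sum_def using ex_subset_card[OF assms(1)] assms(2)
  by (intro mult_pos_pos sum_pos prod_pos) auto

lemma prod_sum_scale:
  fixes s :: "real ^ 'm"
  shows "prod_sum d (c *\<^sub>R s) = c ^ d * prod_sum d s"
proof -
  have "(\<Sum>I | card I = d. \<Prod>i\<in>I. (c *\<^sub>R s) $ i) = (\<Sum>I | card I = d. c ^ d * (\<Prod>i\<in>I. s $ i))"
    by (intro sum.cong) (auto simp: prod.distrib)
  then show ?thesis
    by (simp add: prod_sum_def sum_distrib_left[symmetric])
qed

lemma prod_sum_measurable: "prod_sum d \<in> borel_measurable borel"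
  unfolding prod_sum_def[abs_def]
  by (intro borel_measurable_times borel_measurable_sum borel_measurable_prod) auto

text \<open>
  In logarithmic coordinates, scaling all sides is a diagonal translation, and homogeneity of degree
  \<open>d\<close> says that the logarithm of \<open>\<Phi>\<close> moves by \<open>d\<close> times that translation.
\<close>

lemma (in random_walks) strong_benford_homogeneous:
  fixes \<Phi> :: "real ^ 'm \<Rightarrow> real"
  assumes b: "1 < b" and \<Phi>[measurable]: "\<Phi> \<in> borel_measurable borel"
    and pos: "\<And>s. (\<And>i. 0 < s $ i) \<Longrightarrow> 0 < \<Phi> s"
    and scale: "\<And>s c. 0 < c \<Longrightarrow> \<Phi> (c *\<^sub>R s) = c ^ d * \<Phi> s" and d: "1 \<le> d"
    and w: "0 < w" and gap: "\<And>t. 0 \<le> t \<Longrightarrow> t \<le> w \<Longrightarrow> shift_gap \<nu> t \<longlonglongrightarrow> 0"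
    and X: "\<And>n \<omega>. \<omega> \<in> space M \<Longrightarrow> X n \<omega> = \<Phi> (\<chi> i. b powr (walk y n \<omega> $ i))"
  shows "strong_benford b M X"
proof -
  define F where "F x = log b (\<Phi> (\<chi> i. b powr (x $ i)))" for x
  have [measurable]: "(\<lambda>x :: real ^ 'm. \<chi> i. b powr (x $ i)) \<in> borel_measurable borel"
    by (intro borel_measurable_vec_lambda powr_real_measurable) auto
  have F: "F \<in> borel_measurable borel"
    unfolding F_def[abs_def] by measurable
  have \<Phi>_pos: "0 < \<Phi> (\<chi> i. b powr (x $ i))" for x
    using b by (intro pos) auto
  have equivariant: "F (x + (\<chi> i. t)) = F x + real d * t" for x t
  proof -
    have "(\<chi> i. b powr ((x + (\<chi> i. t)) $ i)) = b powr t *\<^sub>R (\<chi> i. b powr (x $ i))"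
      by (simp add: vec_eq_iff powr_add)
    then have "\<Phi> (\<chi> i. b powr ((x + (\<chi> i. t)) $ i)) = (b powr t) ^ d * \<Phi> (\<chi> i. b powr (x $ i))"
      using b by (simp add: scale)
    also have "(b powr t) ^ d = b powr (real d * t)"
      using b by (simp add: powr_power mult.commute)
    finally show ?thesis
      using b \<Phi>_pos[of x] by (simp add: F_def log_mult)
  qed
  show ?thesis
    unfolding strong_benford_def
  proof (intro conjI allI impI ballI)
    fix n
    have "(\<lambda>\<omega>. \<Phi> (\<chi> i. b powr (walk y n \<omega> $ i))) \<in> borel_measurable M"
      by (intro measurable_compose[OF walk_measurable]) measurable
    then show "X n \<in> borel_measurable M"
      by (subst measurable_cong[OF X])
    show "0 < X n \<omega>" if "\<omega> \<in> space M" for \<omega>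
      using X[OF that] \<Phi>_pos by simp
  next
    fix s assume s: "s \<in> {1..<b}"
    have "0 \<le> log b s" "log b s < 1"
      using s b by auto
    from frac_equivariant_equidistributed[OF F equivariant _ w gap this]
    have "(\<lambda>n. prob {\<omega> \<in> space M. frac (F (walk y n \<omega>)) \<le> log b s}) \<longlonglongrightarrow> log b s"
      using d by simp
    also have "(\<lambda>n. prob {\<omega> \<in> space M. frac (F (walk y n \<omega>)) \<le> log b s})
                 = (\<lambda>n. prob {\<omega> \<in> space M. significand b (X n \<omega>) \<le> s})"
      using s b \<Phi>_pos
      by (intro ext arg_cong[where f = prob] Collect_cong conj_cong) (auto simp: F_def X significand_le_iff)
    finally show "(\<lambda>n. prob {\<omega> \<in> space M. significand b (X n \<omega>) \<le> s}) \<longlonglongrightarrow> log b s" .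
  qed
qed

theorem theorem5:
  fixes B :: nat
    and M :: "'w measure"
    and Bx :: "nat \<Rightarrow> 'w \<Rightarrow> (real ^ 'm) set"
    and P :: "'m \<Rightarrow> nat \<Rightarrow> 'w \<Rightarrow> real"
    and B0 :: "(real ^ 'm) set"
    and X :: "'w \<Rightarrow> real"
    and f :: "real \<Rightarrow> real"
    and \<mu> \<sigma> :: real
  assumes base: "B \<ge> 2"
    and dim: "CARD('m) \<ge> 2"
    and process: "linear_fragmentation M (real B) Bx P \<mu> \<sigma>"
    and start_box: "is_box B0"
    and start: "\<And>\<omega>. \<omega> \<in> space M \<Longrightarrow> Bx 0 \<omega> = B0"
    and indep: "prob_space.indep_vars M (\<lambda>_. borel) (\<lambda>(i, j). P i j) (UNIV \<times> {1..})"
    and X_rv: "X \<in> borel_measurable M"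
    and ident: "\<And>i j. j \<ge> 1 \<Longrightarrow> distr M borel (P i j) = distr M borel X"
    and mean: "\<mu> = prob_space.expectation M (\<lambda>\<omega>. log (real B) (X \<omega>))"
    and var: "\<sigma>\<^sup>2 = prob_space.variance M (\<lambda>\<omega>. log (real B) (X \<omega>))"
    and var_nonzero: "\<sigma>\<^sup>2 \<noteq> 0"
    and moments: "\<And>k::nat. k \<ge> 1 \<Longrightarrow> integrable M (\<lambda>\<omega>. (log (real B) (X \<omega>) - \<mu>) ^ k)"
    and taylor: "has_taylor_expansion_at_0
          (char (distr M borel (\<lambda>\<omega>. (log (real B) (X \<omega>) - \<mu>) / \<sigma>)))"
    and density_nonneg: "\<And>x. 0 \<le> f x"
    and density: "distributed M lborel (\<lambda>\<omega>. log (real B) (X \<omega>)) (\<lambda>x. ennreal (f x))"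
    and density_bounded: "esssup lborel (\<lambda>x. ereal (f x)) < \<infinity>"
    and density_diff: "\<And>x. f differentiable (at x)"
    and density_deriv_bounded: "bdd_above (range (\<lambda>x. \<bar>deriv f x\<bar>))"
  shows "(\<forall>d. 1 \<le> d \<and> d \<le> CARD('m) \<longrightarrow>
            strong_benford (real B) M (\<lambda>N \<omega>. max_product d (Bx N \<omega>))) \<and>
         (\<forall>d. 1 \<le> d \<and> d \<le> CARD('m) \<longrightarrow>
            strong_benford (real B) M (\<lambda>N \<omega>. d_volume d (Bx N \<omega>)))"
proof -
  have f_nonneg: "0 \<le> f x" for x
    by (rule density_nonneg)
  interpret linear_fragmentation M "real B" Bx P \<mu> \<sigma> by (rule process)
  define L where "L i j \<omega> = log (real B) (P i j \<omega>)" for i j \<omega>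
  define \<nu> where "\<nu> = density lborel (\<lambda>x. ennreal (f x))"
  have B: "1 < real B"
    using base by simp
  have law_X: "distr M borel (\<lambda>\<omega>. log (real B) (X \<omega>)) = \<nu>"
  proof -
    have "distr M borel (\<lambda>\<omega>. log (real B) (X \<omega>)) = distr M lborel (\<lambda>\<omega>. log (real B) (X \<omega>))"
      by (rule distr_cong) auto
    then show ?thesis
      using distributed_distr_eq_density[OF density] by (simp add: \<nu>_def)
  qed
  have \<nu>: "real_distribution \<nu>"
  proof -
    have "(\<lambda>\<omega>. log (real B) (X \<omega>)) \<in> borel_measurable M"
      using X_rv by simp
    then have "prob_space \<nu>"
      unfolding law_X[symmetric] by (rule prob_space_distr)
    then show ?thesis
      by (simp add: real_distribution_def real_distribution_axioms_def \<nu>_def)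
  qed
  have P_rv: "P i j \<in> borel_measurable M" if "j \<ge> 1" for i j
    using indep that by (auto simp: indep_vars_def)
  have "random_walks M L \<nu>"
  proof (intro random_walks.intro random_walks_axioms.intro prob_space_axioms)
    have "indep_vars (\<lambda>_. borel) (\<lambda>p \<omega>. log (real B) ((\<lambda>(i, j). P i j) p \<omega>)) (UNIV \<times> {1..})"
      by (rule indep_vars_compose2[OF indep]) measurable
    also have "(\<lambda>p \<omega>. log (real B) ((\<lambda>(i, j). P i j) p \<omega>)) = (\<lambda>(i, j). L i j)"
      by (auto simp: fun_eq_iff L_def)
    finally show "indep_vars (\<lambda>_. borel) (\<lambda>(i, j). L i j) (UNIV \<times> {1..})" .
  next
    fix i :: 'm and j :: nat assume j: "j \<ge> 1"
    have "distr M borel (L i j) = distr (distr M borel (P i j)) borel (log (real B))"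
      using P_rv[OF j] by (subst distr_distr) (auto simp: L_def[abs_def] comp_def)
    also have "\<dots> = distr M borel (\<lambda>\<omega>. log (real B) (X \<omega>))"
      unfolding ident[OF j] using X_rv by (subst distr_distr) (auto simp: comp_def)
    finally show "distr M borel (L i j) = \<nu>"
      by (simp add: law_X)
  qed (rule \<nu>)
  then interpret random_walks M L \<nu> .
  have cont: "continuous_on UNIV f"
    using density_diff
    by (auto simp: continuous_on_eq_continuous_at intro: differentiable_imp_continuous_within)
  obtain w where w: "0 < w"
    and gap: "\<And>t. 0 \<le> t \<Longrightarrow> t \<le> w \<Longrightarrow> shift_gap \<nu> t \<longlonglongrightarrow> 0"
    using shift_gap_density_tendsto_0[of f, OF cont f_nonneg \<nu>[unfolded \<nu>_def]]
    unfolding \<nu>_def by blast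
  define y :: "real ^ 'm" where "y = (\<chi> i. log (real B) (side B0 i))"
  have side_B0: "0 < side B0 i" for i
    using start_box by (auto simp: is_box_def side_cbox)
  have side_walk: "side (Bx n \<omega>) i = real B powr (walk y n \<omega> $ i)" if \<omega>: "\<omega> \<in> space M" for n \<omega> i
  proof (induction n)
    case 0
    then show ?case
      using B side_B0 start[OF \<omega>] by (simp add: walk_def y_def)
  next
    case (Suc n)
    have "0 < P i (Suc n) \<omega>"
      using cuts_range[OF \<omega>] by auto
    then have "P i (Suc n) \<omega> = real B powr L i (Suc n) \<omega>"
      using B by (simp add: L_def)
    then show ?case
      using side_Suc[OF \<omega>] Suc by (simp add: walk_def powr_add)
  qed
  show ?thesis
  proof (intro conjI allI impI)
    fix d assume d: "1 \<le> d \<and> d \<le> CARD('m)"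
    show "strong_benford (real B) M (\<lambda>N \<omega>. max_product d (Bx N \<omega>))"
    proof (rule strong_benford_homogeneous[OF B prod_max_measurable prod_max_pos prod_max_scale _ w gap])
      show "max_product d (Bx n \<omega>) = prod_max d (\<chi> i. real B powr (walk y n \<omega> $ i))"
        if "\<omega> \<in> space M" for n \<omega>
        by (simp add: max_product_def prod_max_def side_walk[OF that])
    qed (use d in auto)
    show "strong_benford (real B) M (\<lambda>N \<omega>. d_volume d (Bx N \<omega>))"
    proof (rule strong_benford_homogeneous[OF B prod_sum_measurable prod_sum_pos prod_sum_scale _ w gap])
      show "d_volume d (Bx n \<omega>) = prod_sum d (\<chi> i. real B powr (walk y n \<omega> $ i))"
        if "\<omega> \<in> space M" for n \<omega>
        by (simp add: d_volume_def prod_sum_def side_walk[OF that])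
    qed (use d in auto)
  qed
qed

end
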